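(* Let $R$ be a commutative ring with identity, $S$ a multiplicatively closed subset of $R$, $M$ a unital $R$-module, and $N$ a submodule of $M$ with $(N:_R M)\cap S=\emptyset$. Then the following are equivalent. (1) $N$ is a weakly $S$-primary submodule of $M$. (2) There exists $s\in S$ such that for all $a\in R$ with $a\notin(\sqrt{(N:_R M)}:s)$, $(N:_M a)\subseteq (0:_M a)\cup (N:_M s)$. (3) There exists $s\in S$ such that for all $a\in R$ with $a\notin(\sqrt{(N:_R M)}:s)$, $(N:_M a)=(0:_M a)$ or $(N:_M a)\subseteq (N:_M s)$. (4) There exists $s\in S$ such that for any $a\in R$ and any submodule $K$ of $M$, if $0\neq aK\subseteq N$, then $sa\in\sqrt{(N:_R M)}$ or $sK\subseteq N$. (5) There exists $s\in S$ such that for any ideal $I$ of $R$ and any submodule $K$ of $M$, if $0\neq IK\subseteq N$, then $sI\subseteq\sqrt{(N:_R M)}$ or $sK\subseteq N$.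
   Context: A multiplicatively closed subset of $R$ is a non-empty subset closed under multiplication. For a submodule $N$ of $M$, $(N:_R M)=\{r\in R: rM\subseteq N\}$; for $a\in R$, $(N:_M a)=\{m\in M: am\in N\}$. For an ideal $I$ of $R$ and $s\in R$, $(I:s)=\{r\in R: rs\in I\}$. A submodule $N$ of $M$ is weakly $S$-primary if $(N:_R M)\cap S=\emptyset$ and there exists a fixed $s\in S$ such that for all $a\in R$ and $m\in M$, $0\neq am\in N$ implies $sa\in\sqrt{(N:_R M)}$ or $sm\in N$. *)

theory Defs
  imports "HOL-Algebra.Ideal" "HOL-Algebra.Module" "HOL-Algebra.Coset"
begin

text \<open>\<open>\<one> \<in> S\<close> is not required, so this is weaker than being a submonoid.\<close>

definition mult_closed :: "('r, 'x) ring_scheme \<Rightarrow> 'r set \<Rightarrow> bool" where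
  "mult_closed R S \<longleftrightarrow>
     S \<subseteq> carrier R \<and> S \<noteq> {} \<and> (\<forall>x\<in>S. \<forall>y\<in>S. x \<otimes>\<^bsub>R\<^esub> y \<in> S)"

definition radical :: "('r, 'x) ring_scheme \<Rightarrow> 'r set \<Rightarrow> 'r set" where
  "radical R I = {r \<in> carrier R. \<exists>n::nat. 0 < n \<and> r [^]\<^bsub>R\<^esub> n \<in> I}"

text \<open>\<open>aK\<close>, the set of all \<open>a k\<close> with \<open>k \<in> K\<close>; the counterpart \<open>sI\<close> inside the ring
  is \<^const>\<open>l_coset\<close>.\<close>

definition smult_set :: "('r, 'm, 'y) module_scheme \<Rightarrow> 'r \<Rightarrow> 'm set \<Rightarrow> 'm set" where
  "smult_set M a K = (\<lambda>k. a \<odot>\<^bsub>M\<^esub> k) ` K"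

text \<open>\<open>(N :\<^sub>R M)\<close>\<close>

definition residual ::
    "('r, 'x) ring_scheme \<Rightarrow> ('r, 'm, 'y) module_scheme \<Rightarrow> 'm set \<Rightarrow> 'r set" where
  "residual R M N = {r \<in> carrier R. smult_set M r (carrier M) \<subseteq> N}"

text \<open>\<open>(N :\<^sub>M a)\<close>\<close>

definition elem_residual :: "('r, 'm, 'y) module_scheme \<Rightarrow> 'm set \<Rightarrow> 'r \<Rightarrow> 'm set" where
  "elem_residual M N a = {m \<in> carrier M. a \<odot>\<^bsub>M\<^esub> m \<in> N}"

text \<open>\<open>(I : s)\<close>\<close>

definition ideal_quotient :: "('r, 'x) ring_scheme \<Rightarrow> 'r set \<Rightarrow> 'r \<Rightarrow> 'r set" where
  "ideal_quotient R I s = {r \<in> carrier R. r \<otimes>\<^bsub>R\<^esub> s \<in> I}"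

text \<open>The product \<open>IK\<close> of an ideal and a submodule: all finite sums of elements \<open>a k\<close> with
  \<open>a \<in> I\<close> and \<open>k \<in> K\<close>. The empty sum needs no
  rule of its own: it arises as \<open>\<zero> \<odot> \<zero>\<close>, both factors having a zero.\<close>

inductive_set ideal_smult :: "('r, 'm, 'y) module_scheme \<Rightarrow> 'r set \<Rightarrow> 'm set \<Rightarrow> 'm set"
  for M and I and K where
  prod: "\<lbrakk>a \<in> I; k \<in> K\<rbrakk> \<Longrightarrow> a \<odot>\<^bsub>M\<^esub> k \<in> ideal_smult M I K"
| sum: "\<lbrakk>x \<in> ideal_smult M I K; y \<in> ideal_smult M I K\<rbrakk> \<Longrightarrow> x \<oplus>\<^bsub>M\<^esub> y \<in> ideal_smult M I K"

definition weakly_S_primary ::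
    "('r, 'x) ring_scheme \<Rightarrow> ('r, 'm, 'y) module_scheme \<Rightarrow> 'r set \<Rightarrow> 'm set \<Rightarrow> bool" where
  "weakly_S_primary R M S N \<longleftrightarrow>
     submodule N R M \<and> residual R M N \<inter> S = {} \<and>
     (\<exists>s\<in>S. \<forall>a\<in>carrier R. \<forall>m\<in>carrier M.
        a \<odot>\<^bsub>M\<^esub> m \<noteq> \<zero>\<^bsub>M\<^esub> \<and> a \<odot>\<^bsub>M\<^esub> m \<in> N \<longrightarrow>
        s \<otimes>\<^bsub>R\<^esub> a \<in> radical R (residual R M N) \<or> s \<odot>\<^bsub>M\<^esub> m \<in> N)"

end

theory Submission
  imports Defs
begin

text \<open>With \<open>s\<close> fixed, the conditions imply each other in a cycle. Two steps rest on the
  fact that a group is never the union of two proper subgroups: \<open>(N :\<^sub>M a)\<close> is covered by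
  \<open>(0 :\<^sub>M a)\<close> and \<open>(N :\<^sub>M s)\<close> in the step from (2) to (3), and \<open>I\<close> is covered by
  the annihilator of \<open>K\<close> and \<open>(\<surd>(N :\<^sub>R M) : s)\<close> in the step from (4) to (5).\<close>

section \<open>Groups covered by two subgroups\<close>

text \<open>Otherwise pick \<open>x\<close> in \<open>C\<close> outside \<open>A\<close> and
  \<open>y\<close> in \<open>C\<close> outside \<open>B\<close>, so that \<open>x\<close> is in
  \<open>B\<close> and \<open>y\<close> in \<open>A\<close>. Their product lies in \<open>A\<close>
  or \<open>B\<close>, and cancelling the factor known to be there puts \<open>x\<close> in
  \<open>A\<close> or \<open>y\<close> in \<open>B\<close>.\<close>

lemma (in group) subgroup_subset_Un:
  assumes A: "subgroup A G" and B: "subgroup B G" and C: "subgroup C G"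
    and sub: "C \<subseteq> A \<union> B"
  shows "C \<subseteq> A \<or> C \<subseteq> B"
proof (rule ccontr)
  assume "\<not> ?thesis"
  then obtain x y where x: "x \<in> C" "x \<notin> A" and y: "y \<in> C" "y \<notin> B"
    by blast
  have xB: "x \<in> B" and yA: "y \<in> A"
    using x y sub by auto
  have xc: "x \<in> carrier G" and yc: "y \<in> carrier G"
    using x y subgroup.mem_carrier[OF C] by auto
  have "x \<otimes> y \<in> A \<or> x \<otimes> y \<in> B"
    using subgroup.m_closed[OF C x(1) y(1)] sub by auto
  then show False
  proof
    assume "x \<otimes> y \<in> A"
    then have "x \<otimes> y \<otimes> inv y \<in> A"
      using A yA by (simp add: subgroup.m_closed subgroup.m_inv_closed)
    then show False
      using x xc yc by (simp add: m_assoc)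
  next
    assume "x \<otimes> y \<in> B"
    then have "inv x \<otimes> (x \<otimes> y) \<in> B"
      using B xB by (simp add: subgroup.m_closed subgroup.m_inv_closed)
    then show False
      using y xc yc by (simp add: m_assoc[symmetric])
  qed
qed

section \<open>Ideals, radicals and quotients in a commutative ring\<close>

text \<open>Negatives arise as multiples by \<open>\<ominus> \<one>\<close>, and commutativity turns
  left absorption into right absorption.\<close>

lemma (in cring) cring_idealI:
  assumes "I \<subseteq> carrier R" and "\<zero> \<in> I"
    and add: "\<And>x y. x \<in> I \<Longrightarrow> y \<in> I \<Longrightarrow> x \<oplus> y \<in> I"
    and mult: "\<And>a x. a \<in> carrier R \<Longrightarrow> x \<in> I \<Longrightarrow> a \<otimes> x \<in> I"
  shows "ideal I R"
proof (rule idealI)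
  show "ring R" ..
  have "\<ominus> x \<in> I" if "x \<in> I" for x
    using mult[of "\<ominus> \<one>" x] that assms(1) l_minus[of \<one> x] by auto
  then show "subgroup I (add_monoid R)"
    using assms by (intro add.subgroupI) (auto simp: a_inv_def)
  show "x \<otimes> a \<in> I" if "a \<in> I" "x \<in> carrier R" for a x
    using mult that by simp
  then show "a \<otimes> x \<in> I" if "a \<in> I" "x \<in> carrier R" for a x
    using that assms(1) m_comm[of a x] by auto
qed

text \<open>Replaces the binomial theorem: a factor \<open>x \<oplus> y\<close> is expanded one at a time.\<close>

lemma (in cring) add_pow_mult_mem_ideal:
  assumes J: "ideal J R" and x: "x \<in> carrier R" and y: "y \<in> carrier R"
    and n: "x [^] (n::nat) \<in> J" and m: "y [^] (m::nat) \<in> J"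
    and "n + m \<le> k + i + j"
  shows "(x \<oplus> y) [^] (k::nat) \<otimes> (x [^] (i::nat) \<otimes> y [^] (j::nat)) \<in> J"
  using assms(6)
\<comment> \<open>Each step moves one factor from the power of \<open>x \<oplus> y\<close> into the
  monomial, raising \<open>i\<close> or \<open>j\<close> by one; the total degree
  \<open>k + i + j\<close> stays constant.\<close>
proof (induction k arbitrary: i j)
  case 0
  interpret J: ideal J R by (rule J)
  have "x [^] i \<otimes> y [^] j \<in> J"
  \<comment> \<open>With \<open>k = 0\<close> the bound reads \<open>n + m \<le> i + j\<close>, so
    \<open>i < n\<close> forces \<open>m \<le> j\<close>: one of the two powers is already in
    \<open>J\<close>.\<close>
  proof (cases "n \<le> i")
    case True
    then have "x [^] i = x [^] (i - n) \<otimes> x [^] n"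
      using x by (simp add: nat_pow_mult)
    then have "x [^] i \<in> J"
      using J.I_l_closed[OF n] x by simp
    then show ?thesis
      using J.I_r_closed y by simp
  next
    case False
    then have "y [^] j = y [^] (j - m) \<otimes> y [^] m"
      using 0 y by (simp add: nat_pow_mult)
    then have "y [^] j \<in> J"
      using J.I_l_closed[OF m] y by simp
    then show ?thesis
      using J.I_l_closed x by simp
  qed
  then show ?case
    using J.a_subset by auto
next
  case (Suc k)
  interpret J: ideal J R by (rule J)
  have "(x \<oplus> y) [^] Suc k \<otimes> (x [^] i \<otimes> y [^] j) =
      (x \<oplus> y) [^] k \<otimes> (x [^] Suc i \<otimes> y [^] j) \<oplus> (x \<oplus> y) [^] k \<otimes> (x [^] i \<otimes> y [^] Suc j)"
    using x y by (simp add: r_distr l_distr m_ac)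
  then show ?case
    using Suc.IH[of "Suc i" j] Suc.IH[of i "Suc j"] Suc.prems by simp
qed

lemma (in cring) radical_ideal:
  assumes J: "ideal J R"
  shows "ideal (radical R J) R"
proof (rule cring_idealI)
  interpret J: ideal J R by (rule J)
  show "radical R J \<subseteq> carrier R"
    by (auto simp: radical_def)
  show "\<zero> \<in> radical R J"
    by (auto simp: radical_def intro!: exI[of _ "1::nat"])
  show "x \<oplus> y \<in> radical R J" if xy: "x \<in> radical R J" "y \<in> radical R J" for x y
  proof -
    obtain n m :: nat where nm: "0 < n" "x [^] n \<in> J" "y [^] m \<in> J"
      and x: "x \<in> carrier R" and y: "y \<in> carrier R"
      using xy by (auto simp: radical_def)
    \<comment> \<open>The induction started from the trivial monomial; \<open>0 < n\<close> keeps
      the exponent \<open>n + m\<close> positive, as \<open>radical\<close> demands.\<close>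
    have "(x \<oplus> y) [^] (n + m) \<in> J"
      using add_pow_mult_mem_ideal[OF J x y nm(2,3), of "n + m" 0 0] x y by simp
    then show ?thesis
      using x y nm(1) by (auto simp: radical_def intro!: exI[of _ "n + m"])
  qed
  show "a \<otimes> x \<in> radical R J" if "a \<in> carrier R" "x \<in> radical R J" for a x
    using that J.I_l_closed by (auto simp: radical_def nat_pow_distrib)
qed

lemma (in cring) ideal_quotient_ideal:
  assumes J: "ideal J R" and s: "s \<in> carrier R"
  shows "ideal (ideal_quotient R J s) R"
proof (rule cring_idealI)
  interpret J: ideal J R by (rule J)
  show "ideal_quotient R J s \<subseteq> carrier R" "\<zero> \<in> ideal_quotient R J s"
    using s by (auto simp: ideal_quotient_def)
  show "x \<oplus> y \<in> ideal_quotient R J s"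
    if "x \<in> ideal_quotient R J s" "y \<in> ideal_quotient R J s" for x y
    using that s by (auto simp: ideal_quotient_def l_distr)
  show "a \<otimes> x \<in> ideal_quotient R J s"
    if "a \<in> carrier R" "x \<in> ideal_quotient R J s" for a x
    using that s J.I_l_closed by (auto simp: ideal_quotient_def m_assoc)
qed

section \<open>Submodules built from residuals, products and single elements\<close>

context module
begin

lemma submodule_zero_closed: "submodule H R M \<Longrightarrow> \<zero>\<^bsub>M\<^esub> \<in> H"
  using subgroup.one_closed[of H "add_monoid M"] by (simp add: submodule.axioms(1))

lemma zero_submodule: "submodule {\<zero>\<^bsub>M\<^esub>} R M"
  by (rule submoduleI) auto

lemma smult_left_commute:
  assumes "a \<in> carrier R" "b \<in> carrier R" "x \<in> carrier M"
  shows "a \<odot>\<^bsub>M\<^esub> (b \<odot>\<^bsub>M\<^esub> x) = b \<odot>\<^bsub>M\<^esub> (a \<odot>\<^bsub>M\<^esub> x)"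
  using assms by (metis smult_assoc1 R.m_comm)

text \<open>This is the preimage of \<open>L\<close> under multiplication by \<open>a\<close>, which
  is linear because \<open>R\<close> is commutative.\<close>

lemma elem_residual_submodule:
  assumes L: "submodule L R M" and a: "a \<in> carrier R"
  shows "submodule (elem_residual M L a) R M"
  using a submoduleE[OF L] submodule_zero_closed[OF L]
  by (intro submoduleI)
    (auto simp: elem_residual_def smult_r_distr smult_r_minus smult_left_commute[of a])

text \<open>Stated for arbitrary \<open>K\<close> and \<open>L\<close> to serve twice:
  \<open>K = carrier M\<close> gives the residual of \<open>L\<close>, and \<open>L\<close> the zero
  submodule gives the annihilator of \<open>K\<close>.\<close>

lemma smult_subset_ideal:
  assumes L: "submodule L R M" and K: "K \<subseteq> carrier M"
  shows "ideal {r \<in> carrier R. smult_set M r K \<subseteq> L} R"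
proof (rule cring_idealI)
  note closed = submoduleE[OF L] submodule_zero_closed[OF L]
  show "{r \<in> carrier R. smult_set M r K \<subseteq> L} \<subseteq> carrier R"
    "\<zero> \<in> {r \<in> carrier R. smult_set M r K \<subseteq> L}"
    using K closed by (auto simp: smult_set_def)
  show "x \<oplus> y \<in> {r \<in> carrier R. smult_set M r K \<subseteq> L}"
    if "x \<in> {r \<in> carrier R. smult_set M r K \<subseteq> L}" "y \<in> {r \<in> carrier R. smult_set M r K \<subseteq> L}"
    for x y
    using that K closed by (auto simp: smult_set_def smult_l_distr subset_iff)
  show "a \<otimes> x \<in> {r \<in> carrier R. smult_set M r K \<subseteq> L}"
    if "a \<in> carrier R" "x \<in> {r \<in> carrier R. smult_set M r K \<subseteq> L}" for a x
    using that K closed by (auto simp: smult_set_def smult_assoc1 subset_iff)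
qed

lemma residual_ideal: "submodule L R M \<Longrightarrow> ideal (residual R M L) R"
  unfolding residual_def by (rule smult_subset_ideal) auto

lemma ideal_smult_subset:
  assumes L: "submodule L R M" and "\<And>a k. a \<in> I \<Longrightarrow> k \<in> K \<Longrightarrow> a \<odot>\<^bsub>M\<^esub> k \<in> L"
  shows "ideal_smult M I K \<subseteq> L"
proof
  show "x \<in> L" if "x \<in> ideal_smult M I K" for x
    using that by induction (use assms submoduleE(5)[OF L] in auto)
qed

text \<open>Allows the condition on submodules to be applied to a single element \<open>m\<close>
  when returning from (5) to (1).\<close>

lemma cyclic_submodule:
  assumes m: "m \<in> carrier M"
  shows "submodule ((\<lambda>r. r \<odot>\<^bsub>M\<^esub> m) ` carrier R) R M"
proof (rule submoduleI)
  show "(\<lambda>r. r \<odot>\<^bsub>M\<^esub> m) ` carrier R \<subseteq> carrier M" "\<zero>\<^bsub>M\<^esub> \<in> (\<lambda>r. r \<odot>\<^bsub>M\<^esub> m) ` carrier R"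
    using m by (auto intro!: image_eqI[of _ _ \<zero>])
next
  fix x assume "x \<in> (\<lambda>r. r \<odot>\<^bsub>M\<^esub> m) ` carrier R"
  then show "\<ominus>\<^bsub>M\<^esub> x \<in> (\<lambda>r. r \<odot>\<^bsub>M\<^esub> m) ` carrier R"
    using m by (auto simp: smult_l_minus[symmetric])
next
  fix x y assume "x \<in> (\<lambda>r. r \<odot>\<^bsub>M\<^esub> m) ` carrier R" "y \<in> (\<lambda>r. r \<odot>\<^bsub>M\<^esub> m) ` carrier R"
  then show "x \<oplus>\<^bsub>M\<^esub> y \<in> (\<lambda>r. r \<odot>\<^bsub>M\<^esub> m) ` carrier R"
    using m by (auto simp: smult_l_distr[symmetric])
next
  fix a x assume "a \<in> carrier R" "x \<in> (\<lambda>r. r \<odot>\<^bsub>M\<^esub> m) ` carrier R"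
  then show "a \<odot>\<^bsub>M\<^esub> x \<in> (\<lambda>r. r \<odot>\<^bsub>M\<^esub> m) ` carrier R"
    using m by (auto simp: smult_assoc1[symmetric])
qed

end

section \<open>Equivalence of the five conditions\<close>

theorem theorem1:
  fixes R :: "('r, 'x) ring_scheme"
    and M :: "('r, 'm, 'y) module_scheme"
    and S :: "'r set" and N :: "'m set"
  assumes "module R M"
    and "mult_closed R S"
    and "submodule N R M"
    and "residual R M N \<inter> S = {}"
  shows "(weakly_S_primary R M S N \<longleftrightarrow>
      (\<exists>s\<in>S. \<forall>a\<in>carrier R.
        a \<notin> ideal_quotient R (radical R (residual R M N)) s \<longrightarrow>
        elem_residual M N a \<subseteq> elem_residual M {\<zero>\<^bsub>M\<^esub>} a \<union> elem_residual M N s)) \<and>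
    (weakly_S_primary R M S N \<longleftrightarrow>
      (\<exists>s\<in>S. \<forall>a\<in>carrier R.
        a \<notin> ideal_quotient R (radical R (residual R M N)) s \<longrightarrow>
        elem_residual M N a = elem_residual M {\<zero>\<^bsub>M\<^esub>} a \<or>
        elem_residual M N a \<subseteq> elem_residual M N s)) \<and>
    (weakly_S_primary R M S N \<longleftrightarrow>
      (\<exists>s\<in>S. \<forall>a\<in>carrier R. \<forall>K. submodule K R M \<longrightarrow>
        smult_set M a K \<noteq> {\<zero>\<^bsub>M\<^esub>} \<and> smult_set M a K \<subseteq> N \<longrightarrow>
        s \<otimes>\<^bsub>R\<^esub> a \<in> radical R (residual R M N) \<or> smult_set M s K \<subseteq> N)) \<and>
    (weakly_S_primary R M S N \<longleftrightarrow>
      (\<exists>s\<in>S. \<forall>I K. ideal I R \<longrightarrow> submodule K R M \<longrightarrow>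
        ideal_smult M I K \<noteq> {\<zero>\<^bsub>M\<^esub>} \<and> ideal_smult M I K \<subseteq> N \<longrightarrow>
        s <#\<^bsub>R\<^esub> I \<subseteq> radical R (residual R M N) \<or> smult_set M s K \<subseteq> N))"
proof -
  interpret module R M by (rule assms(1))
  note N = assms(3)
  let ?P = "radical R (residual R M N)"
  \<comment> \<open>Each condition is stripped of its existential quantifier, so the whole cycle can
    be run with one and the same \<open>s\<close>.\<close>
  define c1 where "c1 s \<longleftrightarrow> (\<forall>a\<in>carrier R. \<forall>m\<in>carrier M.
      a \<odot>\<^bsub>M\<^esub> m \<noteq> \<zero>\<^bsub>M\<^esub> \<and> a \<odot>\<^bsub>M\<^esub> m \<in> N \<longrightarrow> s \<otimes>\<^bsub>R\<^esub> a \<in> ?P \<or> s \<odot>\<^bsub>M\<^esub> m \<in> N)" for s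
  define c2 where "c2 s \<longleftrightarrow> (\<forall>a\<in>carrier R. a \<notin> ideal_quotient R ?P s \<longrightarrow>
      elem_residual M N a \<subseteq> elem_residual M {\<zero>\<^bsub>M\<^esub>} a \<union> elem_residual M N s)" for s
  define c3 where "c3 s \<longleftrightarrow> (\<forall>a\<in>carrier R. a \<notin> ideal_quotient R ?P s \<longrightarrow>
      elem_residual M N a = elem_residual M {\<zero>\<^bsub>M\<^esub>} a \<or>
      elem_residual M N a \<subseteq> elem_residual M N s)" for s
  define c4 where "c4 s \<longleftrightarrow> (\<forall>a\<in>carrier R. \<forall>K. submodule K R M \<longrightarrow>
      smult_set M a K \<noteq> {\<zero>\<^bsub>M\<^esub>} \<and> smult_set M a K \<subseteq> N \<longrightarrow>
      s \<otimes>\<^bsub>R\<^esub> a \<in> ?P \<or> smult_set M s K \<subseteq> N)" for s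
  define c5 where "c5 s \<longleftrightarrow> (\<forall>I K. ideal I R \<longrightarrow> submodule K R M \<longrightarrow>
      ideal_smult M I K \<noteq> {\<zero>\<^bsub>M\<^esub>} \<and> ideal_smult M I K \<subseteq> N \<longrightarrow>
      s <#\<^bsub>R\<^esub> I \<subseteq> ?P \<or> smult_set M s K \<subseteq> N)" for s
  note N_zero = submodule_zero_closed[OF N]
  have quot_ideal: "ideal (ideal_quotient R ?P s) R" if "s \<in> carrier R" for s
    using that by (intro ideal_quotient_ideal radical_ideal residual_ideal N)
  have quot_iff: "a \<in> ideal_quotient R ?P s \<longleftrightarrow> s \<otimes>\<^bsub>R\<^esub> a \<in> ?P"
    if "a \<in> carrier R" "s \<in> carrier R" for a s
    using that by (simp add: ideal_quotient_def R.m_comm)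
  have c12: "c2 s" if s: "s \<in> carrier R" and "c1 s" for s
    using that unfolding c1_def c2_def by (auto simp: quot_iff elem_residual_def)
  have c23: "c3 s" if s: "s \<in> carrier R" and c2: "c2 s" for s
    unfolding c3_def
  proof (intro ballI impI)
    fix a assume a: "a \<in> carrier R" and "a \<notin> ideal_quotient R ?P s"
    with c2 have "elem_residual M N a \<subseteq> elem_residual M {\<zero>\<^bsub>M\<^esub>} a \<union> elem_residual M N s"
      by (simp add: c2_def)
    then have "elem_residual M N a \<subseteq> elem_residual M {\<zero>\<^bsub>M\<^esub>} a \<or>
        elem_residual M N a \<subseteq> elem_residual M N s"
      using a s N zero_submodule
      by (intro M.add.subgroup_subset_Un submodule.axioms(1)[of _ R M] elem_residual_submodule)
    \<comment> \<open>Upgrades the first alternative from inclusion to the equality that (3) asks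
      for.\<close>
    moreover have "elem_residual M {\<zero>\<^bsub>M\<^esub>} a \<subseteq> elem_residual M N a"
      using N_zero by (auto simp: elem_residual_def)
    ultimately show "elem_residual M N a = elem_residual M {\<zero>\<^bsub>M\<^esub>} a \<or>
        elem_residual M N a \<subseteq> elem_residual M N s"
      by blast
  qed
  have c34: "c4 s" if s: "s \<in> carrier R" and c3: "c3 s" for s
    unfolding c4_def
  proof (intro ballI allI impI disjCI)
    fix a K
    assume a: "a \<in> carrier R" and K: "submodule K R M" and sK: "\<not> smult_set M s K \<subseteq> N"
      and aK: "smult_set M a K \<noteq> {\<zero>\<^bsub>M\<^esub>} \<and> smult_set M a K \<subseteq> N"
    have K_sub: "K \<subseteq> carrier M" and K_ne: "K \<noteq> {}"
      using submoduleE[OF K] by auto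
    have K_res: "K \<subseteq> elem_residual M N a"
      using aK K_sub by (auto simp: elem_residual_def smult_set_def)
    have "\<not> K \<subseteq> elem_residual M {\<zero>\<^bsub>M\<^esub>} a"
    proof
      assume "K \<subseteq> elem_residual M {\<zero>\<^bsub>M\<^esub>} a"
      then have "smult_set M a K \<subseteq> {\<zero>\<^bsub>M\<^esub>}"
        by (auto simp: elem_residual_def smult_set_def)
      \<comment> \<open>\<open>K\<close> is nonempty, so its image under \<open>a\<close> is
        nonempty too and inclusion in the zero submodule would be equality.\<close>
      then show False
        using aK K_ne by (simp add: subset_singleton_iff smult_set_def)
    qed
    moreover have "\<not> K \<subseteq> elem_residual M N s"
      using sK by (auto simp: elem_residual_def smult_set_def)
    \<comment> \<open>\<open>K\<close> lies in \<open>elem_residual M N a\<close> but in neither of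
      the sets offered by (3), so both alternatives fail for \<open>a\<close>.\<close>
    ultimately have "a \<in> ideal_quotient R ?P s"
      using c3 a K_res unfolding c3_def by blast
    then show "s \<otimes>\<^bsub>R\<^esub> a \<in> ?P"
      using quot_iff a s by simp
  qed
  have c45: "c5 s" if s: "s \<in> carrier R" and c4: "c4 s" for s
    unfolding c5_def
  proof (intro allI impI disjCI)
    fix I K
    assume I: "ideal I R" and K: "submodule K R M" and sK: "\<not> smult_set M s K \<subseteq> N"
      and IK: "ideal_smult M I K \<noteq> {\<zero>\<^bsub>M\<^esub>} \<and> ideal_smult M I K \<subseteq> N"
    interpret I: ideal I R by (rule I)
    define A where "A = {r \<in> carrier R. smult_set M r K \<subseteq> {\<zero>\<^bsub>M\<^esub>}}"
    have A: "ideal A R"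
      unfolding A_def using zero_submodule submoduleE(1)[OF K] by (rule smult_subset_ideal)
    \<comment> \<open>Since \<open>sK\<close> is not inside \<open>N\<close>, applying (4) to a
      single \<open>a\<close> in \<open>I\<close> leaves only \<open>aK = 0\<close> or
      \<open>sa\<close> in the radical. Which one holds may depend on \<open>a\<close>; the covering
      lemma makes the choice uniform.\<close>
    have "I \<subseteq> A \<union> ideal_quotient R ?P s"
    proof
      fix a assume a: "a \<in> I"
      have "smult_set M a K \<subseteq> N"
        using IK a by (auto simp: smult_set_def intro: ideal_smult.prod)
      then have "s \<otimes>\<^bsub>R\<^esub> a \<in> ?P \<or> smult_set M a K = {\<zero>\<^bsub>M\<^esub>}"
        using c4 I.Icarr[OF a] K sK unfolding c4_def by blast
      then show "a \<in> A \<union> ideal_quotient R ?P s"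
        using I.Icarr[OF a] s quot_iff by (auto simp: A_def)
    qed
    then have "I \<subseteq> A \<or> I \<subseteq> ideal_quotient R ?P s"
      using I A quot_ideal[OF s]
      by (intro R.add.subgroup_subset_Un additive_subgroup.a_subgroup ideal.axioms(1))
    moreover have "\<not> I \<subseteq> A"
    proof
      assume "I \<subseteq> A"
      then have "ideal_smult M I K \<subseteq> {\<zero>\<^bsub>M\<^esub>}"
        by (intro ideal_smult_subset zero_submodule) (auto simp: A_def smult_set_def)
      \<comment> \<open>Shows that the product is nonempty, so that lying inside the zero submodule
        contradicts being different from it.\<close>
      moreover have "\<zero>\<^bsub>R\<^esub> \<odot>\<^bsub>M\<^esub> \<zero>\<^bsub>M\<^esub> \<in> ideal_smult M I K"
        by (intro ideal_smult.prod submodule_zero_closed K I.zero_closed)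
      ultimately show False
        using IK by auto
    qed
    ultimately show "s <#\<^bsub>R\<^esub> I \<subseteq> ?P"
      using s quot_iff by (auto simp: l_coset_def)
  qed
  have c51: "c1 s" if s: "s \<in> carrier R" and c5: "c5 s" for s
    unfolding c1_def
  proof (intro ballI impI)
    fix a m
    assume a: "a \<in> carrier R" and m: "m \<in> carrier M"
      and am: "a \<odot>\<^bsub>M\<^esub> m \<noteq> \<zero>\<^bsub>M\<^esub> \<and> a \<odot>\<^bsub>M\<^esub> m \<in> N"
    \<comment> \<open>Take the principal ideal \<open>Ra\<close> and the cyclic submodule
      \<open>Rm\<close>: every product of their elements is a multiple of \<open>am\<close>, so
      \<open>IK\<close> stays in \<open>N\<close>, while \<open>am\<close> itself makes it
      nonzero.\<close>
    define I where "I = cgenideal R a"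
    define K where "K = (\<lambda>r. r \<odot>\<^bsub>M\<^esub> m) ` carrier R"
    have I: "ideal I R" and aI: "a \<in> I"
      using a by (auto simp: I_def intro: cgenideal_ideal cgenideal_self)
    have K: "submodule K R M" and mK: "m \<in> K"
      using m by (auto simp: K_def intro: cyclic_submodule intro!: image_eqI[of _ _ "\<one>\<^bsub>R\<^esub>"])
    have "ideal_smult M I K \<subseteq> N"
    proof (rule ideal_smult_subset[OF N])
      fix b k assume "b \<in> I" "k \<in> K"
      then obtain r t where "r \<in> carrier R" "t \<in> carrier R" "b = r \<otimes>\<^bsub>R\<^esub> a" "k = t \<odot>\<^bsub>M\<^esub> m"
        by (auto simp: I_def K_def cgenideal_def)
      \<comment> \<open>Rearranged, \<open>(ra)(tm) = r(t(am))\<close>, and \<open>N\<close> absorbs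
        scalars.\<close>
      then show "b \<odot>\<^bsub>M\<^esub> k \<in> N"
        using a m am submoduleE(4)[OF N] by (simp add: smult_assoc1 smult_left_commute[of a])
    qed
    moreover have "a \<odot>\<^bsub>M\<^esub> m \<in> ideal_smult M I K"
      using aI mK by (rule ideal_smult.prod)
    ultimately have "s <#\<^bsub>R\<^esub> I \<subseteq> ?P \<or> smult_set M s K \<subseteq> N"
      using c5 I K am unfolding c5_def by blast
    then show "s \<otimes>\<^bsub>R\<^esub> a \<in> ?P \<or> s \<odot>\<^bsub>M\<^esub> m \<in> N"
      using aI mK by (auto simp: l_coset_def smult_set_def)
  qed
  have S: "s \<in> carrier R" if "s \<in> S" for s
    using assms(2) that by (auto simp: mult_closed_def)
  have c1: "weakly_S_primary R M S N \<longleftrightarrow> (\<exists>s\<in>S. c1 s)"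
    using assms(3,4) by (simp add: weakly_S_primary_def c1_def)
  \<comment> \<open>For each \<open>s\<close> in \<open>S\<close> the closed cycle makes all five
    predicates equivalent, so a witness for one is a witness for every other.\<close>
  have c2: "weakly_S_primary R M S N \<longleftrightarrow> (\<exists>s\<in>S. c2 s)"
    using S c1 c12 c23 c34 c45 c51 by meson
  have c3: "weakly_S_primary R M S N \<longleftrightarrow> (\<exists>s\<in>S. c3 s)"
    using S c1 c12 c23 c34 c45 c51 by meson
  have c4: "weakly_S_primary R M S N \<longleftrightarrow> (\<exists>s\<in>S. c4 s)"
    using S c1 c12 c23 c34 c45 c51 by meson
  have c5: "weakly_S_primary R M S N \<longleftrightarrow> (\<exists>s\<in>S. c5 s)"
    using S c1 c12 c23 c34 c45 c51 by meson
  show ?thesis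
    using c2 c3 c4 c5 unfolding c2_def c3_def c4_def c5_def by (intro conjI)
qed

end
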